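(* Let $L\ge 2$ and $n_0\ge 1$ be integers. Let $\phi:\mathbb{R}\to\mathbb{R}$ be surjective and monotonically increasing, let $W_j\in\mathbb{R}^{n_0\times n_0}$ be full-rank (square) matrices and $b_j\in\mathbb{R}^{n_0}$ for $j=1,\dots,L$, and let $F:\mathbb{R}^{n_0}\to\mathbb{R}^{n_0}$ be the neural network function (autoencoder) with weights $W_j$, biases $b_j$ and activation function $\phi$. If $x^*\in\mathbb{R}^{n_0}$ is an attractive point of $F$, then the basin of attraction $B(x^* )$ is path-connected.
   Context: A function $\phi:\mathbb{R}\to\mathbb{R}$ is monotonically increasing if $x<y$ implies $\phi(x)\le\phi(y)$ (not necessarily strictly). It is applied to vectors coordinate-wise. The neural network function $F:=F_L$ with weights $W_j$, biases $b_j$ ($j=1,\dots,L$) and activation $\phi$ is defined recursively by $F_1(x)=\phi(W_1x+b_1)$, $F_k(x)=\phi(W_kF_{k-1}(x)+b_k)$ for $k=2,\dots,L-1$, and $F_L(x)=W_LF_{L-1}(x)+b_L$ (no activation in the last layer). It is called an autoencoder if its input and output dimensions coincide. For $f:\mathbb{R}^n\to\mathbb{R}^n$, $f^k$ denotes the $k$-fold composition. A point $x^*\in\mathbb{R}^n$ is an attractive point of $f$ if there is an open neighbourhood $\mathcal{O}$ of $x^*$ such that $f^k(x)\to x^*$ as $k\to\infty$ for all $x\in\mathcal{O}$. Its basin of attraction is $B(x^* )=\{x\in\mathbb{R}^n: f^k(x)\to x^* \text{ as } k\to\infty\}$. A set $C\subset\mathbb{R}^n$ is path-connected if for all $x_1,x_2\in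 C$ there is a continuous $\gamma:[0,1]\to C$ with $\gamma(0)=x_1$ and $\gamma(1)=x_2$. *)

theory Defs
  imports "HOL-Analysis.Analysis"
begin

definition map_vec :: "(real \<Rightarrow> real) \<Rightarrow> real ^ 'n \<Rightarrow> real ^ 'n"
  where "map_vec \<phi> v = (\<chi> i. \<phi> (v $ i))"

text \<open>
  Networks all of whose layers have the same width \<open>CARD('n)\<close>; they are in particular
  autoencoders. Layers are numbered from 1, so \<open>W 0\<close> and \<open>b 0\<close> are never used:
  \<open>hidden_layer \<phi> W b k\<close> is $F_k$ for $1 \le k \le L-1$, and the value at 0 is the network input.
\<close>

primrec hidden_layer ::
  "(real \<Rightarrow> real) \<Rightarrow> (nat \<Rightarrow> real ^ 'n ^ 'n) \<Rightarrow> (nat \<Rightarrow> real ^ 'n) \<Rightarrow> nat \<Rightarrow> real ^ 'n \<Rightarrow> real ^ 'n"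
  where
    "hidden_layer \<phi> W b 0 x = x"
  | "hidden_layer \<phi> W b (Suc k) x = map_vec \<phi> (W (Suc k) *v hidden_layer \<phi> W b k x + b (Suc k))"

text \<open>Meaningful for \<open>L \<ge> 2\<close>.\<close>

definition neural_network ::
  "(real \<Rightarrow> real) \<Rightarrow> (nat \<Rightarrow> real ^ 'n ^ 'n) \<Rightarrow> (nat \<Rightarrow> real ^ 'n) \<Rightarrow> nat \<Rightarrow> real ^ 'n \<Rightarrow> real ^ 'n"
  where "neural_network \<phi> W b L x = W L *v hidden_layer \<phi> W b (L - 1) x + b L"

definition attractive_point :: "('a::topological_space \<Rightarrow> 'a) \<Rightarrow> 'a \<Rightarrow> bool"
  where "attractive_point f p \<longleftrightarrow>
    (\<exists>U. open U \<and> p \<in> U \<and> (\<forall>x\<in>U. (\<lambda>k. (f ^^ k) x) \<longlonglongrightarrow> p))"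

definition basin_of_attraction :: "('a::topological_space \<Rightarrow> 'a) \<Rightarrow> 'a \<Rightarrow> 'a set"
  where "basin_of_attraction f p = {x. (\<lambda>k. (f ^^ k) x) \<longlonglongrightarrow> p}"

end

theory Submission
  imports Defs
begin

text \<open>
  A monotone surjection of the line is continuous and proper, and its fibres are intervals. Hence
  its coordinatewise extension is a closed continuous surjection with convex fibres, and so, like an
  affine bijection, it pulls connected sets back to connected sets. These properties are inherited
  by the network \<open>F\<close>. If \<open>U\<close> is a ball around the attractive point contained in the basin, then
  the basin is the union of the open connected, hence path-connected, sets \<open>(F ^^ k) -` U\<close>,
  all of which contain the fixed point \<open>x_star\<close>.
\<close>

text \<open>Continuity is bundled in so that preimages of balls are open as well as connected.
  Path-connectedness would be the wrong invariant: if \<open>\<phi>\<close> has flat pieces, the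
  preimage of a path can look like the topologist's sine curve.\<close>

definition pulls_back_connected :: "('a::topological_space \<Rightarrow> 'b::topological_space) \<Rightarrow> bool"
  where "pulls_back_connected f \<longleftrightarrow>
    continuous_on UNIV f \<and> (\<forall>S. connected S \<longrightarrow> connected (f -` S))"

lemma pulls_back_connected_comp:
  assumes "pulls_back_connected f" "pulls_back_connected g"
  shows "pulls_back_connected (f \<circ> g)"
  unfolding pulls_back_connected_def
proof (intro conjI allI impI)
  show "continuous_on UNIV (f \<circ> g)"
    using assms unfolding pulls_back_connected_def
    by (intro continuous_on_compose) (blast intro: continuous_on_subset)+
  show "connected ((f \<circ> g) -` S)" if "connected S" for S
    using assms that by (simp add: pulls_back_connected_def vimage_comp[symmetric])
qed

lemma pulls_back_connected_id: "pulls_back_connected id"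
  by (simp add: pulls_back_connected_def)

lemma pulls_back_connected_funpow:
  fixes f :: "'a::topological_space \<Rightarrow> 'a"
  assumes "pulls_back_connected f"
  shows "pulls_back_connected (f ^^ k)"
proof (induction k)
  case 0
  show ?case
    unfolding funpow.simps by (rule pulls_back_connected_id)
next
  case (Suc k)
  show ?case
    unfolding funpow.simps using assms Suc by (rule pulls_back_connected_comp)
qed

lemma pulls_back_connected_affine:
  fixes A :: "real ^ 'n ^ 'n"
  assumes "rank A = CARD('n)"
  shows "pulls_back_connected (\<lambda>x. A *v x + c)"
proof -
  have "inj ((*v) A)"
    using assms by (simp add: full_rank_injective)
  then have "invertible A"
    by (simp add: invertible_left_inverse matrix_left_invertible_injective)
  then obtain B where B: "A ** B = mat 1" "B ** A = mat 1"
    by (auto simp: invertible_def)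
  have *: "A *v (B *v y) = y" "B *v (A *v x) = x" for x y
    by (simp_all add: B matrix_vector_mul_assoc)
  \<comment> \<open>As an image under the continuous inverse affine map, the preimage inherits
    connectedness.\<close>
  have "(\<lambda>x. A *v x + c) -` S = (\<lambda>y. B *v (y - c)) ` S" for S
  proof (intro set_eqI iffI)
    show "x \<in> (\<lambda>y. B *v (y - c)) ` S" if "x \<in> (\<lambda>x. A *v x + c) -` S" for x
      using that by (intro image_eqI[of _ _ "A *v x + c"]) (simp_all add: *)
  qed (auto simp: *)
  moreover have "continuous_on S (\<lambda>y. B *v (y - c))" for S
    by (rule continuous_on_compose2[OF matrix_vector_mult_linear_continuous_on[of UNIV]])
      (auto intro: continuous_on_diff continuous_on_id continuous_on_const)
  moreover have "continuous_on UNIV (\<lambda>x. A *v x + c)"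
    by (intro continuous_on_add matrix_vector_mult_linear_continuous_on continuous_on_const)
  ultimately show ?thesis
    by (simp add: pulls_back_connected_def connected_continuous_image)
qed

text \<open>A jump of a monotone function would leave a gap in its range.\<close>

lemma continuous_on_mono_surj:
  fixes \<phi> :: "real \<Rightarrow> real"
  assumes "mono \<phi>" "surj \<phi>"
  shows "continuous_on UNIV \<phi>"
  using assms by (intro continuous_onI_mono) (auto dest: monoD)

lemma continuous_on_map_vec:
  fixes \<phi> :: "real \<Rightarrow> real"
  assumes "continuous_on UNIV \<phi>"
  shows "continuous_on UNIV (map_vec \<phi> :: real ^ 'n \<Rightarrow> real ^ 'n)"
  unfolding map_vec_def
  by (intro continuous_on_vec_lambda continuous_on_compose2[OF assms] continuous_intros) auto

lemma surj_map_vec: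
  assumes "surj \<phi>"
  shows "surj (map_vec \<phi>)"
proof (rule surjI)
  show "map_vec \<phi> (map_vec (inv \<phi>) v) = v" for v
    by (simp add: map_vec_def vec_eq_iff surj_f_inv_f[OF assms])
qed

text \<open>The fibre is the product of the fibres of \<open>\<phi>\<close> over the coordinates of
  \<open>v\<close>, and monotonicity makes each factor an interval.\<close>

lemma convex_vimage_map_vec:
  fixes \<phi> :: "real \<Rightarrow> real" and v :: "real ^ 'n"
  assumes "mono \<phi>"
  shows "convex (map_vec \<phi> -` {v})"
proof -
  \<comment> \<open>Betweenness in each coordinate, with either order of the endpoints, is the form
    to which \<open>is_interval_cart\<close> unfolds.\<close>
  have "z \<in> map_vec \<phi> -` {v}"
    if x: "x \<in> map_vec \<phi> -` {v}" and y: "y \<in> map_vec \<phi> -` {v}"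
      and z: "\<forall>i. x $ i \<le> z $ i \<and> z $ i \<le> y $ i \<or> y $ i \<le> z $ i \<and> z $ i \<le> x $ i"
    for x y z :: "real ^ 'n"
  proof -
    have "\<phi> (z $ i) = v $ i" for i
    proof -
      have "\<phi> (x $ i) = v $ i" "\<phi> (y $ i) = v $ i"
        using x y by (simp_all add: map_vec_def vec_eq_iff)
      then show ?thesis
        using z[rule_format, of i] monoD[OF assms, of "x $ i" "z $ i"]
          monoD[OF assms, of "z $ i" "y $ i"] monoD[OF assms, of "y $ i" "z $ i"]
          monoD[OF assms, of "z $ i" "x $ i"] by auto
    qed
    then show ?thesis
      by (simp add: map_vec_def vec_eq_iff)
  qed
  then have "is_interval (map_vec \<phi> -` {v})"
    unfolding is_interval_cart by blast
  then show ?thesis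
    by (rule is_interval_convex)
qed

text \<open>Properness is the reason: a convergent sequence of image points is bounded, so its
  preimages lie in one fixed box, and the image of the compact part of \<open>C\<close> in that box
  is closed.\<close>

lemma closed_map_vec_image:
  fixes \<phi> :: "real \<Rightarrow> real" and C :: "(real ^ 'n) set"
  assumes "mono \<phi>" "surj \<phi>" "closed C"
  shows "closed (map_vec \<phi> ` C)"
  unfolding closed_sequential_limits
proof (intro allI impI, elim conjE)
  fix y :: "nat \<Rightarrow> real ^ 'n" and l
  assume y: "\<forall>n. y n \<in> map_vec \<phi> ` C" and lim: "y \<longlonglongrightarrow> l"
  obtain R where R: "\<And>n. norm (y n) \<le> R"
    using convergent_imp_bounded[OF lim] by (auto simp: bounded_iff)
  \<comment> \<open>The margin 1 makes the comparisons with values in [-R, R] strict; only strict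
    inequalities between values of a monotone function carry over to the arguments.\<close>
  obtain p q where pq: "\<phi> p = - R - 1" "\<phi> q = R + 1"
    using surjD[OF \<open>surj \<phi>\<close>, of "- R - 1"] surjD[OF \<open>surj \<phi>\<close>, of "R + 1"] by fastforce
  let ?K = "C \<inter> cbox (\<chi> i. p) (\<chi> i. q)"
  have "compact (map_vec \<phi> ` ?K)"
  proof (rule compact_continuous_image)
    show "continuous_on ?K (map_vec \<phi>)"
      by (rule continuous_on_subset[OF continuous_on_map_vec[OF continuous_on_mono_surj]])
        (use assms in simp_all)
    show "compact ?K"
      using \<open>closed C\<close> by (rule closed_Int_compact) (rule compact_cbox)
  qed
  then have "closed (map_vec \<phi> ` ?K)"
    by (rule compact_imp_closed)
  moreover have "y n \<in> map_vec \<phi> ` ?K" for n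
  proof -
    obtain x where x: "x \<in> C" "y n = map_vec \<phi> x"
      using y by blast
    have "p \<le> x $ i \<and> x $ i \<le> q" for i
    proof -
      have "\<bar>\<phi> (x $ i)\<bar> \<le> R"
        using order_trans[OF component_le_norm_cart R, of n i] by (simp add: x map_vec_def)
      then have "\<phi> p < \<phi> (x $ i)" "\<phi> (x $ i) < \<phi> q"
        using pq by auto
      then show ?thesis
        using mono_strict_invE[OF \<open>mono \<phi>\<close>] by (auto intro: less_imp_le)
    qed
    then show ?thesis
      using x by (auto simp: mem_box_cart)
  qed
  ultimately have "l \<in> map_vec \<phi> ` ?K"
    using lim by (rule closed_sequentially)
  then show "l \<in> map_vec \<phi> ` C"
    by blast
qed

lemma pulls_back_connected_map_vec:
  fixes \<phi> :: "real \<Rightarrow> real"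
  assumes "mono \<phi>" "surj \<phi>"
  shows "pulls_back_connected (map_vec \<phi> :: real ^ 'n \<Rightarrow> real ^ 'n)"
  unfolding pulls_back_connected_def
proof (intro conjI allI impI)
  show cont: "continuous_on UNIV (map_vec \<phi> :: real ^ 'n \<Rightarrow> real ^ 'n)"
    using assms by (intro continuous_on_map_vec continuous_on_mono_surj)
  show "connected (map_vec \<phi> -` S)" if "connected S" for S :: "(real ^ 'n) set"
    \<comment> \<open>Connected fibres cannot be split, so a separation of the preimage would
      consist of whole fibres and descend along the closed surjection to a separation of
      \<open>S\<close>.\<close>
    using connected_closed_monotone_preimage[OF cont surj_map_vec[OF \<open>surj \<phi>\<close>] _ _ that] assms
    by (simp add: closed_map_vec_image convex_connected convex_vimage_map_vec)
qed

lemma pulls_back_connected_hidden_layer: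
  fixes W :: "nat \<Rightarrow> real ^ 'n ^ 'n"
  assumes "mono \<phi>" "surj \<phi>" "\<And>j. j \<in> {1..k} \<Longrightarrow> rank (W j) = CARD('n)"
  shows "pulls_back_connected (hidden_layer \<phi> W b k)"
  using assms(3)
proof (induction k)
  case 0
  have "hidden_layer \<phi> W b 0 = id"
    by auto
  then show ?case
    by (simp only: pulls_back_connected_id)
next
  case (Suc k)
  have "hidden_layer \<phi> W b (Suc k) =
      map_vec \<phi> \<circ> (\<lambda>x. W (Suc k) *v x + b (Suc k)) \<circ> hidden_layer \<phi> W b k"
    by auto
  moreover have "pulls_back_connected \<dots>"
    using Suc assms(1,2)
    by (intro pulls_back_connected_comp pulls_back_connected_map_vec pulls_back_connected_affine) auto
  ultimately show ?case
    by (simp only:)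
qed

lemma pulls_back_connected_neural_network:
  fixes W :: "nat \<Rightarrow> real ^ 'n ^ 'n"
  assumes "L \<ge> 1" "mono \<phi>" "surj \<phi>" "\<And>j. j \<in> {1..L} \<Longrightarrow> rank (W j) = CARD('n)"
  shows "pulls_back_connected (neural_network \<phi> W b L)"
proof -
  have "neural_network \<phi> W b L = (\<lambda>x. W L *v x + b L) \<circ> hidden_layer \<phi> W b (L - 1)"
    by (auto simp: neural_network_def)
  \<comment> \<open>\<open>L \<ge> 1\<close> puts the output index \<open>L\<close> into the range
    of the rank hypothesis.\<close>
  moreover have "pulls_back_connected \<dots>"
    using assms by (intro pulls_back_connected_comp pulls_back_connected_affine
        pulls_back_connected_hidden_layer) auto
  ultimately show ?thesis
    by simp
qed

text \<open>The orbit of \<open>p\<close> itself tends to \<open>p\<close>; by continuity the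
  shifted orbit tends to \<open>f p\<close>, and limits are unique.\<close>

lemma attractive_point_fixed:
  fixes f :: "'a::t2_space \<Rightarrow> 'a"
  assumes "continuous_on UNIV f" "attractive_point f p"
  shows "f p = p"
proof -
  have lim: "(\<lambda>k. (f ^^ k) p) \<longlonglongrightarrow> p"
    using assms(2) by (auto simp: attractive_point_def)
  have "(\<lambda>k. f ((f ^^ k) p)) \<longlonglongrightarrow> f p"
    using continuous_on_tendsto_compose[OF assms(1) lim] by simp
  moreover have "(\<lambda>k. f ((f ^^ k) p)) \<longlonglongrightarrow> p"
    using LIMSEQ_Suc[OF lim] by simp
  ultimately show ?thesis
    by (rule LIMSEQ_unique)
qed

text \<open>Convergence ignores finitely many initial terms. Read from left to right, this keeps
  iterated preimages of a ball in the basin inside the basin.\<close>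

lemma funpow_mem_basin_iff:
  "(f ^^ k) x \<in> basin_of_attraction f p \<longleftrightarrow> x \<in> basin_of_attraction f p"
proof -
  have "(f ^^ n) ((f ^^ k) x) = (f ^^ (n + k)) x" for n
    by (simp add: funpow_add)
  then show ?thesis
    using LIMSEQ_ignore_initial_segment[of "\<lambda>n. (f ^^ n) x" p k]
      LIMSEQ_offset[of "\<lambda>n. (f ^^ n) x" k p]
    unfolding basin_of_attraction_def mem_Collect_eq by (simp only:) blast
qed

lemma path_connected_basin_of_pulls_back_connected:
  fixes f :: "'a::euclidean_space \<Rightarrow> 'a"
  assumes f: "pulls_back_connected f" and p: "attractive_point f p"
  shows "path_connected (basin_of_attraction f p)"
proof -
  let ?B = "basin_of_attraction f p"
  have "f p = p"
    using f p by (intro attractive_point_fixed) (auto simp: pulls_back_connected_def)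
  then have fixed: "(f ^^ k) p = p" for k
    by (induction k) auto
  obtain V where "open V" "p \<in> V" "V \<subseteq> ?B"
    using p by (auto simp: attractive_point_def basin_of_attraction_def)
  then obtain r where r: "r > 0" "ball p r \<subseteq> ?B"
    by (meson open_contains_ball order_trans)
  have "path_component ?B p x" if "x \<in> ?B" for x
  proof -
    have "\<forall>\<^sub>F k in sequentially. (f ^^ k) x \<in> ball p r"
      using that r by (intro topological_tendstoD) (auto simp: basin_of_attraction_def)
    then obtain k where k: "(f ^^ k) x \<in> ball p r"
      by (auto simp: eventually_sequentially)
    let ?S = "(f ^^ k) -` ball p r"
    have "pulls_back_connected (f ^^ k)"
      using f by (rule pulls_back_connected_funpow)
    then have "connected ?S" "open ?S"
      by (auto simp: pulls_back_connected_def intro: open_vimage)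
    \<comment> \<open>Open subsets of a Euclidean space are locally path-connected, so here
      connectedness suffices.\<close>
    then have "path_connected ?S"
      by (simp add: connected_open_path_connected)
    moreover have "p \<in> ?S" "x \<in> ?S"
      using k r fixed by auto
    ultimately have "path_component ?S p x"
      by (auto simp: path_connected_component)
    moreover have "?S \<subseteq> ?B"
      using r funpow_mem_basin_iff by fastforce
    ultimately show ?thesis
      by (rule path_component_of_subset[rotated])
  qed
  then show ?thesis
    \<comment> \<open>Any two points of the basin are joined by way of \<open>p\<close>.\<close>
    unfolding path_connected_component by (meson path_component_sym path_component_trans)
qed

theorem theorem2p7:
  fixes \<phi> :: "real \<Rightarrow> real"
    and W :: "nat \<Rightarrow> real ^ 'n ^ 'n"
    and b :: "nat \<Rightarrow> real ^ 'n"
    and L :: nat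
    and x_star :: "real ^ 'n"
  assumes "L \<ge> 2"
    and "surj \<phi>"
    and "mono \<phi>"
    and "\<And>j. j \<in> {1..L} \<Longrightarrow> rank (W j) = CARD('n)"
    and "attractive_point (neural_network \<phi> W b L) x_star"
  shows "path_connected (basin_of_attraction (neural_network \<phi> W b L) x_star)"
  using assms
  by (intro path_connected_basin_of_pulls_back_connected pulls_back_connected_neural_network) auto

end
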